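(* Let $T:[1,\infty)\to(0,\infty)$ be a non-decreasing function of lower order $\ell\in(0,\infty)$, and let $\varepsilon>0$. Then the set $$K_2=\{r\ge1: r^{\ell-\varepsilon}\le T(r)\le r^{\ell+\varepsilon}\}$$ satisfies $\overline{\operatorname{logdens}}(K_2)\ge\dfrac{\varepsilon}{\ell+\varepsilon}$.
   Context: The lower order of a non-decreasing function $T:[1,\infty)\to(0,\infty)$ is $\liminf_{r\to\infty}\frac{\log T(r)}{\log r}$. The upper logarithmic density of a measurable set $D\subset[1,\infty)$ is $$\overline{\operatorname{logdens}}(D)=\limsup_{r\to\infty}\frac{1}{\log r}\int_{D\cap[1,r]}\frac{dt}{t}.$$ *)

theory Defs
  imports "HOL-Analysis.Analysis"
begin

definition lower_order :: "(real \<Rightarrow> real) \<Rightarrow> ereal" where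
  "lower_order T = Liminf at_top (\<lambda>r. ereal (ln (T r) / ln r))"

text \<open>Only meaningful for Lebesgue measurable \<^term>\<open>D\<close>; otherwise the integrals may take
  the default value 0.\<close>

definition upper_logdens :: "real set \<Rightarrow> ereal" where
  "upper_logdens D =
     Limsup at_top (\<lambda>r. ereal (1 / ln r * (LINT t:D \<inter> {1..r}|lebesgue. 1 / t)))"

end

theory Submission
  imports Defs
begin

text \<open>Let \<open>0 < c < \<epsilon> / (l + \<epsilon>)\<close> and \<open>b = 1 - c\<close>, so that \<open>b (l + \<epsilon>) > l\<close>. There are arbitrarily
  large \<open>s\<close> with \<open>T s < s powr (b (l + \<epsilon>))\<close>. By monotonicity every \<open>t \<in> [s powr b, s]\<close> then satisfies
  \<open>T t \<le> T s \<le> t powr (l + \<epsilon>)\<close>, while the lower bound on \<open>T t\<close> holds for all large \<open>t\<close>. Hence the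
  set contains \<open>[s powr b, s]\<close>, whose logarithmic measure is \<open>c ln s\<close>.\<close>

lemma frequently_less_of_Liminf_less:
  fixes X :: "'a \<Rightarrow> 'b :: complete_linorder"
  assumes "Liminf F X < C"
  shows "\<exists>\<^sub>F x in F. X x < C"
proof (rule ccontr)
  assume "\<not> ?thesis"
  then have "\<forall>\<^sub>F x in F. C \<le> X x"
    by (simp add: not_frequently not_less)
  then have "C \<le> Liminf F X"
    by (rule Liminf_bounded)
  with assms show False
    by simp
qed

text \<open>Since \<open>T\<close> is arbitrary below 1, it is replaced by
  \<open>T (max 1 r)\<close>, which is monotone on the whole line, hence Borel, and agrees with
  \<open>T\<close> on the set in question.\<close>

lemma powr_sandwich_set_borel:
  fixes T :: "real \<Rightarrow> real"
  assumes "mono_on {1..} T"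
  shows "{r. r \<ge> 1 \<and> r powr p \<le> T r \<and> T r \<le> r powr q} \<in> sets borel"
proof -
  have "mono (\<lambda>r. T (max 1 r))"
    by (intro monoI mono_onD[OF assms]) auto
  then have [measurable]: "(\<lambda>r. T (max 1 r)) \<in> borel_measurable borel"
    by (rule borel_measurable_mono)
  have "{r \<in> space borel. r \<ge> 1 \<and> r powr p \<le> T (max 1 r) \<and> T (max 1 r) \<le> r powr q} \<in> sets borel"
    by measurable
  also have "{r \<in> space borel. r \<ge> 1 \<and> r powr p \<le> T (max 1 r) \<and> T (max 1 r) \<le> r powr q} =
      {r. r \<ge> 1 \<and> r powr p \<le> T r \<and> T r \<le> r powr q}"
    by (auto simp: max_def)
  finally show ?thesis .
qed

text \<open>The integrand is nonnegative, so shrinking the domain to \<open>{a..s}\<close> can only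
  lower the integral, and there \<open>ln\<close> is an antiderivative. Measurability of
  \<open>D\<close> gives integrability, so the integral is not a default value.\<close>

lemma ln_diff_le_log_measure:
  fixes a s :: real
  assumes D: "D \<in> sets lebesgue" and sub: "{a..s} \<subseteq> D" and a: "1 \<le> a" "a \<le> s"
  shows "ln s - ln a \<le> (LINT t:D \<inter> {1..s}|lebesgue. 1 / t)"
proof -
  have I: "set_integrable lebesgue {1..s} (\<lambda>t. 1 / t)"
    by (intro absolutely_integrable_continuous_real continuous_intros) auto
  have J: "set_integrable lebesgue (D \<inter> {1..s}) (\<lambda>t. 1 / t)"
    by (rule set_integrable_subset[OF I]) (use D in auto)
  have "((\<lambda>t. 1 / t) has_integral (ln s - ln a)) {a..s}"
    using a by (intro fundamental_theorem_of_calculus)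
      (auto intro!: derivative_eq_intros simp flip: has_real_derivative_iff_has_vector_derivative)
  moreover note set_lebesgue_integral_eq_integral[OF J]
  ultimately show ?thesis
    using integral_subset_le[of "{a..s}" "D \<inter> {1..s}" "\<lambda>t. 1 / t"] sub a
    by (auto simp: integral_unique has_integral_integrable)
qed

theorem corollary4p3:
  fixes T :: "real \<Rightarrow> real" and l \<epsilon> :: real
  assumes "\<And>r. r \<ge> 1 \<Longrightarrow> T r > 0"
    and "mono_on {1..} T"
    and "lower_order T = ereal l"
    and "l > 0"
    and "\<epsilon> > 0"
  shows "upper_logdens {r. r \<ge> 1 \<and> r powr (l - \<epsilon>) \<le> T r \<and> T r \<le> r powr (l + \<epsilon>)}
           \<ge> ereal (\<epsilon> / (l + \<epsilon>))"
proof (rule ccontr)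
  define K where "K = {r. r \<ge> 1 \<and> r powr (l - \<epsilon>) \<le> T r \<and> T r \<le> r powr (l + \<epsilon>)}"
  assume "\<not> ?thesis"
  \<comment> \<open>The maximum with 0 ensures that the intermediate \<open>c\<close> is positive,
    whence \<open>b < 1\<close> below.\<close>
  then have "max 0 (upper_logdens K) < ereal (\<epsilon> / (l + \<epsilon>))"
    using assms(4,5) by (simp add: K_def not_le)
  then obtain c where "max 0 (upper_logdens K) < ereal c" "ereal c < ereal (\<epsilon> / (l + \<epsilon>))"
    using ereal_dense2 by blast
  then have c: "upper_logdens K < ereal c" "0 < c" "c < \<epsilon> / (l + \<epsilon>)"
    by auto
  define b where "b = 1 - c"
  have le: "l + \<epsilon> > 0" and "l < b * (l + \<epsilon>)"
    using c(3) assms(4,5) by (auto simp: b_def field_simps)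
  \<comment> \<open>Positivity of \<open>b\<close> follows from
    \<open>b * (l + \<epsilon>) > l > 0\<close>.\<close>
  then have b: "0 < b" "b < 1"
    using assms(4) c(2) zero_less_mult_pos2[of b "l + \<epsilon>"] by (auto simp: b_def)
  have "\<forall>\<^sub>F t in at_top. ereal (l - \<epsilon>) < ereal (ln (T t) / ln t)"
    by (rule less_LiminfD) (use assms(3,5) in \<open>simp add: lower_order_def\<close>)
  then obtain R where R: "l - \<epsilon> < ln (T t) / ln t" if "t \<ge> R" for t
    by (auto simp: eventually_at_top_linorder)
  have lower: "t powr (l - \<epsilon>) \<le> T t" if t: "t \<ge> R" "t > 1" for t
  proof -
    have "(l - \<epsilon>) * ln t \<le> ln (T t)"
      using R[OF t(1)] t(2) by (simp add: field_simps)
    then have "exp ((l - \<epsilon>) * ln t) \<le> T t"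
      using assms(1)[of t] t(2) by (simp add: ln_ge_iff)
    then show ?thesis
      using t(2) by (simp add: powr_def)
  qed
  have "\<exists>\<^sub>F s in at_top. ereal (ln (T s) / ln s) < ereal (b * (l + \<epsilon>))"
    by (rule frequently_less_of_Liminf_less)
      (use assms(3) \<open>l < b * (l + \<epsilon>)\<close> in \<open>simp add: lower_order_def\<close>)
  \<comment> \<open>The threshold on \<open>s\<close> is chosen so that \<open>s powr b\<close> is
    at least \<open>max R 1\<close>; the lower bound on \<open>T\<close> is then available on all of
    \<open>[s powr b, s]\<close>.\<close>
  moreover have "\<forall>\<^sub>F s in at_top.
      ereal (1 / ln s * (LINT t:K \<inter> {1..s}|lebesgue. 1 / t)) < ereal c \<and>
      s > 1 \<and> s \<ge> max R 1 powr (1 / b)"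
    using c(1) unfolding upper_logdens_def
    by (intro eventually_conj Limsup_lessD eventually_gt_at_top eventually_ge_at_top)
  ultimately obtain s where s: "ln (T s) / ln s < b * (l + \<epsilon>)" "s > 1" "s \<ge> max R 1 powr (1 / b)"
    and small: "1 / ln s * (LINT t:K \<inter> {1..s}|lebesgue. 1 / t) < c"
    using frequently_ex[OF frequently_eventually_frequently] by fastforce
  define a where "a = s powr b"
  have a: "R \<le> a" "1 < a" "a \<le> s" "ln a = b * ln s"
  proof -
    have "max R 1 = (max R 1 powr (1 / b)) powr b"
      using b by (simp add: powr_powr)
    also have "\<dots> \<le> a"
      unfolding a_def using s b by (intro powr_mono2) auto
    finally show "R \<le> a" by simp
    show "1 < a" using s b by (simp add: a_def)
    show "a \<le> s" using s b powr_mono[of b 1 s] by (simp add: a_def)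
    show "ln a = b * ln s" using s by (simp add: a_def ln_powr)
  qed
  have "{a..s} \<subseteq> K"
  proof
    fix t assume t: "t \<in> {a..s}"
    have "ln (T s) \<le> (b * (l + \<epsilon>)) * ln s"
      using s by (simp add: field_simps)
    then have "T s \<le> exp ((b * (l + \<epsilon>)) * ln s)"
      using assms(1)[of s] s by (metis exp_le_cancel_iff exp_ln less_imp_le)
    \<comment> \<open>As \<open>ln a = b * ln s\<close>, the factor \<open>b\<close> is absorbed
      into the base, and the bound at \<open>s\<close> becomes the desired bound at the left
      endpoint \<open>a\<close>.\<close>
    also have "\<dots> = a powr (l + \<epsilon>)"
      using a by (simp add: powr_def mult_ac)
    also have "\<dots> \<le> t powr (l + \<epsilon>)"
      using t a le by (intro powr_mono2) auto
    finally have "T s \<le> t powr (l + \<epsilon>)" .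
    moreover have "T t \<le> T s"
      using t a by (intro mono_onD[OF assms(2)]) auto
    ultimately show "t \<in> K"
      using lower[of t] t a by (simp add: K_def)
  qed
  moreover have "K \<in> sets lebesgue"
    using powr_sandwich_set_borel[OF assms(2)] unfolding K_def by (intro sets_completionI_sets) simp
  ultimately have "ln s - ln a \<le> (LINT t:K \<inter> {1..s}|lebesgue. 1 / t)"
    using a by (intro ln_diff_le_log_measure) auto
  \<comment> \<open>Here \<open>ln s - ln a = (1 - b) * ln s = c * ln s\<close>, which contradicts
    the strict inequality \<open>small\<close> after division by \<open>ln s > 0\<close>.\<close>
  then have "c * ln s \<le> (LINT t:K \<inter> {1..s}|lebesgue. 1 / t)"
    by (simp add: a b_def algebra_simps)
  with small s(2) show False
    by (simp add: field_simps)
qed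

end
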